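(* Let $(A,J)$ and $(B,K)$ be flip pairs. If there is a $D_\infty$-strong shift equivalence of lag $l$ from $(A,J)$ to $(B,K)$ for some positive integer $l$, then the Lind zeta functions of $(\mathsf{X}_A,\sigma_A,\varphi_{A,J})$ and $(\mathsf{X}_B,\sigma_B,\varphi_{B,K})$ are the same.
   Context: Flip pairs. Let $\mathcal{A}$ be a finite set. A pair $(A,J)$ of zero-one $\mathcal{A}\times\mathcal{A}$ matrices is a flip pair if $JA=A^{\mathsf T}J$ and $J^2=I$. There is then a unique map $\tau_J:\mathcal{A}\to\mathcal{A}$ with $J(a,b)=1$ if and only if $\tau_J(a)=b$, and $\tau_J^2=\mathrm{id}$. Let $\mathsf{X}_A=\{x\in\mathcal{A}^{\mathbb Z}: A(x_i,x_{i+1})=1\ \text{for all } i\in\mathbb{Z}\}$, let $\sigma_A$ be the restriction to $\mathsf{X}_A$ of the shift map $\sigma(x)_i=x_{i+1}$, and let $\varphi_{A,J}:\mathsf{X}_A\to\mathsf{X}_A$ be given by $\varphi_{A,J}(x)_i=\tau_J(x_{-i})$. Then $\varphi_{A,J}$ is a homeomorphism with $\varphi_{A,J}\circ\sigma_A=\sigma_A^{-1}\circ\varphi_{A,J}$ and $\varphi_{A,J}^2=\mathrm{id}$. Let $(A,J)$ and $(B,K)$ be flip pairs, indexed by finite sets $\mathcal{A}$ and $\mathcal{B}$ respectively. A half elementary equivalence from $(A,J)$ to $(B,K)$ is a pair $(R,S)$ of zero-one matrices ($R$ is $\mathcal{A}\times\mathcal{B}$, $S$ is $\mathcal{B}\times\mathcal{A}$)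 satisfying $A=RS$, $B=SR$ and $S=KR^{\mathsf T}J$. A $D_\infty$-strong shift equivalence of lag $l$ from $(A,J)$ to $(B,K)$ is a sequence of $l$ half elementary equivalences $(R_i,S_i)$ from $(A_i,J_i)$ to $(A_{i+1},J_{i+1})$, $i=1,\dots,l$, where the $(A_i,J_i)$ are flip pairs, $(A_1,J_1)=(A,J)$ and $(A_{l+1},J_{l+1})=(B,K)$. Lind zeta function. For an action $\alpha$ of a group $G$ on a set $X$, let $\mathcal{F}$ be the set of finite index subgroups of $G$, and for $H\in\mathcal{F}$ let $p_H(\alpha)=|\{x\in X:\alpha(h,x)=x\ \text{for all } h\in H\}|$. The Lind zeta function of $\alpha$ is the formal power series $\zeta_\alpha(t)=\exp\left(\sum_{H\in\mathcal{F}}\frac{p_H(\alpha)}{|G/H|}t^{|G/H|}\right)$. Let $D_\infty=\langle a,b: ab=ba^{-1},\ b^2=1\rangle$. The Lind zeta function of $(\mathsf{X}_A,\sigma_A,\varphi_{A,J})$ is that of the $D_\infty$-action $\alpha$ on $\mathsf{X}_A$ determined by $\alpha(a,x)=\sigma_A(x)$ and $\alpha(b,x)=\varphi_{A,J}(x)$. *)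

theory Defs
  imports
    "HOL-Algebra.Group_Action"
    "HOL-Algebra.Generated_Groups"
    "HOL-Computational_Algebra.Formal_Power_Series"
begin

section \<open>Zero-one matrices indexed by finite sets\<close>

text \<open>
  A matrix with rows indexed by a set \<open>I\<close> and columns indexed by a set \<open>I'\<close> is a function
  of two arguments of which only the values on \<open>I \<times> I'\<close> are meaningful.  All index sets are
  subsets of one type \<open>'a\<close>, which is arbitrary (in particular possibly infinite); any family
  of finite sets can be realised in this way.
\<close>

type_synonym 'a matrix = "'a \<Rightarrow> 'a \<Rightarrow> nat"

definition zero_one_mat :: "'a set \<Rightarrow> 'a set \<Rightarrow> 'a matrix \<Rightarrow> bool" where
  "zero_one_mat I I' M \<longleftrightarrow> (\<forall>i\<in>I. \<forall>j\<in>I'. M i j \<in> {0, 1})"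

definition mat_eq :: "'a set \<Rightarrow> 'a set \<Rightarrow> 'a matrix \<Rightarrow> 'a matrix \<Rightarrow> bool" where
  "mat_eq I I' M N \<longleftrightarrow> (\<forall>i\<in>I. \<forall>j\<in>I'. M i j = N i j)"

text \<open>The set \<open>I\<close> is the one indexing the columns of \<open>M\<close> and the rows of \<open>N\<close>.\<close>

definition mat_mult :: "'a set \<Rightarrow> 'a matrix \<Rightarrow> 'a matrix \<Rightarrow> 'a matrix" where
  "mat_mult I M N = (\<lambda>i j. \<Sum>k\<in>I. M i k * N k j)"

definition mat_transpose :: "'a matrix \<Rightarrow> 'a matrix" where
  "mat_transpose M = (\<lambda>i j. M j i)"

definition mat_id :: "'a matrix" where
  "mat_id = (\<lambda>i j. if i = j then 1 else 0)"


section \<open>Flip pairs and strong shift equivalence\<close>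

definition flip_pair :: "'a set \<Rightarrow> 'a matrix \<Rightarrow> 'a matrix \<Rightarrow> bool" where
  "flip_pair I A J \<longleftrightarrow>
     finite I \<and> zero_one_mat I I A \<and> zero_one_mat I I J \<and>
     mat_eq I I (mat_mult I J A) (mat_mult I (mat_transpose A) J) \<and>
     mat_eq I I (mat_mult I J J) mat_id"

definition half_elementary_equivalence ::
  "'a set \<Rightarrow> 'a matrix \<Rightarrow> 'a matrix \<Rightarrow> 'a set \<Rightarrow> 'a matrix \<Rightarrow> 'a matrix \<Rightarrow>
   'a matrix \<Rightarrow> 'a matrix \<Rightarrow> bool" where
  "half_elementary_equivalence I A J I' B K R S \<longleftrightarrow>
     zero_one_mat I I' R \<and> zero_one_mat I' I S \<and>
     mat_eq I I A (mat_mult I' R S) \<and>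
     mat_eq I' I' B (mat_mult I S R) \<and>
     mat_eq I' I S (mat_mult I (mat_mult I' K (mat_transpose R)) J)"

definition Dinf_strong_shift_equivalence ::
  "nat \<Rightarrow> 'a set \<Rightarrow> 'a matrix \<Rightarrow> 'a matrix \<Rightarrow> 'a set \<Rightarrow> 'a matrix \<Rightarrow> 'a matrix \<Rightarrow> bool" where
  "Dinf_strong_shift_equivalence l I A J I' B K \<longleftrightarrow>
     (\<exists>Is As Js Rs Ss.
        (\<forall>i\<in>{1..l + 1}. flip_pair (Is i) (As i) (Js i)) \<and>
        Is 1 = I \<and> As 1 = A \<and> Js 1 = J \<and>
        Is (l + 1) = I' \<and> As (l + 1) = B \<and> Js (l + 1) = K \<and>
        (\<forall>i\<in>{1..l}. half_elementary_equivalence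
            (Is i) (As i) (Js i) (Is (i + 1)) (As (i + 1)) (Js (i + 1)) (Rs i) (Ss i)))"


section \<open>The shift space and the flip of a flip pair\<close>

definition flip_perm :: "'a set \<Rightarrow> 'a matrix \<Rightarrow> 'a \<Rightarrow> 'a" where
  "flip_perm I J a = (THE b. b \<in> I \<and> J a b = 1)"

definition shift_space :: "'a set \<Rightarrow> 'a matrix \<Rightarrow> (int \<Rightarrow> 'a) set" where
  "shift_space I A = {x. (\<forall>i. x i \<in> I) \<and> (\<forall>i. A (x i) (x (i + 1)) = 1)}"

definition shift_map :: "'a set \<Rightarrow> 'a matrix \<Rightarrow> (int \<Rightarrow> 'a) \<Rightarrow> (int \<Rightarrow> 'a)" where
  "shift_map I A = (\<lambda>x\<in>shift_space I A. \<lambda>i. x (i + 1))"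

definition flip_map :: "'a set \<Rightarrow> 'a matrix \<Rightarrow> 'a matrix \<Rightarrow> (int \<Rightarrow> 'a) \<Rightarrow> (int \<Rightarrow> 'a)" where
  "flip_map I A J = (\<lambda>x\<in>shift_space I A. \<lambda>i. flip_perm I J (x (- i)))"


section \<open>The infinite dihedral group\<close>

text \<open>
  The pair \<open>(k, e)\<close> stands for \<open>a\<^sup>k b\<^sup>e\<close>, with \<open>e\<close> read modulo 2.  The lemmas \<open>Dinf_relations\<close> and
  \<open>Dinf_universal\<close> below show that this is the group presented by
  \<open>\<langle>a, b : ab = ba\<^sup>-\<^sup>1, b\<^sup>2 = 1\<rangle>\<close>.
\<close>

definition Dinf :: "(int \<times> bool) monoid" where
  "Dinf = \<lparr>carrier = UNIV,
     monoid.mult = (\<lambda>(k, e) (m, f). (k + (if e then - m else m), e \<noteq> f)),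
     one = (0, False)\<rparr>"

definition Dinf_a :: "int \<times> bool" where "Dinf_a = (1, False)"
definition Dinf_b :: "int \<times> bool" where "Dinf_b = (0, True)"

definition Dinf_hom :: "('g, 'm) monoid_scheme \<Rightarrow> 'g \<Rightarrow> 'g \<Rightarrow> int \<times> bool \<Rightarrow> 'g" where
  "Dinf_hom G x y = (\<lambda>(k, e). x [^]\<^bsub>G\<^esub> k \<otimes>\<^bsub>G\<^esub> (if e then y else \<one>\<^bsub>G\<^esub>))"

lemma Dinf_simps [simp]:
  "carrier Dinf = UNIV"
  "(k, e) \<otimes>\<^bsub>Dinf\<^esub> (m, f) = (k + (if e then - m else m), e \<noteq> f)"
  "\<one>\<^bsub>Dinf\<^esub> = (0, False)"
  by (auto simp: Dinf_def)

lemma group_Dinf: "group Dinf"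
proof (rule groupI)
  fix x :: "int \<times> bool"
  obtain k e where "x = (k, e)" by (cases x)
  then have "(if e then k else - k, e) \<otimes>\<^bsub>Dinf\<^esub> x = \<one>\<^bsub>Dinf\<^esub>" by auto
  then show "\<exists>y\<in>carrier Dinf. y \<otimes>\<^bsub>Dinf\<^esub> x = \<one>\<^bsub>Dinf\<^esub>" by (metis Dinf_simps(1) UNIV_I)
qed auto

lemma Dinf_inv: "inv\<^bsub>Dinf\<^esub> (k, e) = (if e then k else - k, e)"
  by (rule group.inv_equality [OF group_Dinf]) auto

lemma Dinf_relations:
  "Dinf_a \<otimes>\<^bsub>Dinf\<^esub> Dinf_b = Dinf_b \<otimes>\<^bsub>Dinf\<^esub> inv\<^bsub>Dinf\<^esub> Dinf_a"
  "Dinf_b \<otimes>\<^bsub>Dinf\<^esub> Dinf_b = \<one>\<^bsub>Dinf\<^esub>"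
  by (auto simp: Dinf_a_def Dinf_b_def Dinf_inv)

lemma Dinf_nat_pow: "(k, False) [^]\<^bsub>Dinf\<^esub> (n::nat) = (int n * k, False)"
proof (induction n)
  case 0
  show ?case using monoid.nat_pow_0[OF group.is_monoid[OF group_Dinf]] by simp
next
  case (Suc n)
  then show ?case
    using monoid.nat_pow_Suc[OF group.is_monoid[OF group_Dinf]] by (simp add: algebra_simps)
qed

lemma Dinf_int_pow: "(k, False) [^]\<^bsub>Dinf\<^esub> (n::int) = (n * k, False)"
  by (simp add: int_pow_def2 Dinf_nat_pow Dinf_inv del: pow_nat)

lemma Dinf_normal_form:
  "(k, e) = Dinf_a [^]\<^bsub>Dinf\<^esub> k \<otimes>\<^bsub>Dinf\<^esub> (if e then Dinf_b else \<one>\<^bsub>Dinf\<^esub>)"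
  by (simp add: Dinf_a_def Dinf_b_def Dinf_int_pow)

lemma (in group) swap_nat_pow:
  assumes "u \<in> carrier G" "v \<in> carrier G" "y \<in> carrier G" "y \<otimes> u = v \<otimes> y"
  shows "y \<otimes> u [^] (n::nat) = v [^] n \<otimes> y"
proof (induction n)
  case (Suc n)
  have "y \<otimes> (u [^] n \<otimes> u) = (v [^] n \<otimes> y) \<otimes> u" using Suc assms by (simp add: m_assoc[symmetric])
  also have "\<dots> = v [^] n \<otimes> (v \<otimes> y)" using assms by (simp add: m_assoc)
  finally show ?case using assms by (simp add: m_assoc)
qed (use assms(3) in simp)

lemma (in group) dihedral_swap:
  assumes x: "x \<in> carrier G" and y: "y \<in> carrier G" and xy: "x \<otimes> y = y \<otimes> inv x"
  shows "y \<otimes> x [^] (m::int) = x [^] (- m) \<otimes> y"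
proof -
  have *: "y \<otimes> x = inv x \<otimes> y"
  proof -
    have "inv x \<otimes> y = inv x \<otimes> (y \<otimes> inv x \<otimes> x)" using x y by (simp add: m_assoc)
    also have "\<dots> = inv x \<otimes> (x \<otimes> y \<otimes> x)" using xy by simp
    also have "\<dots> = (inv x \<otimes> x) \<otimes> (y \<otimes> x)" using x y by (simp only: m_assoc inv_closed m_closed)
    also have "\<dots> = y \<otimes> x" using x y by simp
    finally show ?thesis by simp
  qed
  show ?thesis
  proof (cases "m < 0")
    case True
    have "y \<otimes> (inv x) [^] nat (- m) = x [^] nat (- m) \<otimes> y"
      by (rule swap_nat_pow[OF inv_closed[OF x] x y xy[symmetric]])
    moreover have "x [^] m = (inv x) [^] nat (- m)" "x [^] (- m) = x [^] nat (- m)"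
      using True x by (simp_all add: int_pow_def2 nat_pow_inv del: pow_nat)
    ultimately show ?thesis by (simp only:)
  next
    case False
    have "y \<otimes> x [^] nat m = (inv x) [^] nat m \<otimes> y"
      by (rule swap_nat_pow[OF x inv_closed[OF x] y *])
    moreover have "x [^] m = x [^] nat m" "x [^] (- m) = (inv x) [^] nat m"
      using False x by (cases "m = 0"; simp add: int_pow_def2 nat_pow_inv del: pow_nat)+
    ultimately show ?thesis by (simp only:)
  qed
qed

lemma (in group) Dinf_hom_hom:
  assumes x: "x \<in> carrier G" and y: "y \<in> carrier G"
    and xy: "x \<otimes> y = y \<otimes> inv x" and yy: "y \<otimes> y = \<one>"
  shows "Dinf_hom G x y \<in> hom Dinf G"
proof (rule homI)
  show "Dinf_hom G x y g \<in> carrier G" for g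
    using x y by (auto simp: Dinf_hom_def split: prod.split)
next
  fix g h :: "int \<times> bool"
  obtain k e m f where [simp]: "g = (k, e)" "h = (m, f)" by (cases g, cases h)
  have 1: "(x [^] k \<otimes> y) \<otimes> (x [^] m \<otimes> w) = x [^] (k - m) \<otimes> (y \<otimes> w)" if "w \<in> carrier G" for w
  proof -
    have "(x [^] k \<otimes> y) \<otimes> (x [^] m \<otimes> w) = x [^] k \<otimes> (y \<otimes> x [^] m) \<otimes> w"
      using x y that by (simp add: m_assoc)
    also have "\<dots> = x [^] k \<otimes> (x [^] (- m) \<otimes> y) \<otimes> w"
      using dihedral_swap[OF x y xy] by simp
    also have "\<dots> = (x [^] k \<otimes> x [^] (- m)) \<otimes> (y \<otimes> w)"
      using x y that by (simp add: m_assoc)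
    also have "\<dots> = x [^] (k - m) \<otimes> (y \<otimes> w)"
      using x by (simp add: int_pow_mult[symmetric])
    finally show ?thesis .
  qed
  have 2: "x [^] k \<otimes> (x [^] m \<otimes> w) = x [^] (k + m) \<otimes> w" if "w \<in> carrier G" for w
    using x that by (simp add: int_pow_mult m_assoc)
  show "Dinf_hom G x y (g \<otimes>\<^bsub>Dinf\<^esub> h) = Dinf_hom G x y g \<otimes> Dinf_hom G x y h"
    using x y yy 1[of y] 1[of \<one>] 2[of y] 2[of \<one>] by (auto simp: Dinf_hom_def)
qed

lemma (in group) Dinf_hom_unique:
  assumes h: "h \<in> hom Dinf G" and "h Dinf_a = x" "h Dinf_b = y"
  shows "h = Dinf_hom G x y"
proof
  fix g :: "int \<times> bool"
  obtain k e where g: "g = (k, e)" by (cases g)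
  interpret h: group_hom Dinf G h
    using h group_Dinf is_group by (simp add: group_hom_def group_hom_axioms_def)
  have "h g = h (Dinf_a [^]\<^bsub>Dinf\<^esub> k) \<otimes> h (if e then Dinf_b else \<one>\<^bsub>Dinf\<^esub>)"
    unfolding g by (subst Dinf_normal_form, rule h.hom_mult) simp_all
  also have "\<dots> = x [^] k \<otimes> (if e then y else \<one>)"
    using assms h.hom_one h.hom_int_pow[of Dinf_a k] by auto
  finally show "h g = Dinf_hom G x y g" by (simp add: g Dinf_hom_def)
qed

lemma (in group) Dinf_universal:
  assumes "x \<in> carrier G" "y \<in> carrier G" "x \<otimes> y = y \<otimes> inv x" "y \<otimes> y = \<one>"
  shows "\<exists>!h. h \<in> hom Dinf G \<and> h Dinf_a = x \<and> h Dinf_b = y"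
proof (rule ex1I[of _ "Dinf_hom G x y"])
  show "Dinf_hom G x y \<in> hom Dinf G \<and> Dinf_hom G x y Dinf_a = x \<and> Dinf_hom G x y Dinf_b = y"
    using assms Dinf_hom_hom[OF assms] by (simp add: Dinf_hom_def Dinf_a_def Dinf_b_def)
qed (use Dinf_hom_unique in blast)


section \<open>The Lind zeta function\<close>

definition finite_index_subgroups :: "('g, 'm) monoid_scheme \<Rightarrow> 'g set set" where
  "finite_index_subgroups G = {H. subgroup H G \<and> finite (rcosets\<^bsub>G\<^esub> H)}"

definition fixed_points :: "'x set \<Rightarrow> ('g \<Rightarrow> 'x \<Rightarrow> 'x) \<Rightarrow> 'g set \<Rightarrow> 'x set" where
  "fixed_points X \<alpha> H = {x \<in> X. \<forall>h\<in>H. \<alpha> h x = x}"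

text \<open>
  The exponent is a formal sum over all subgroups of finite index; its coefficient at \<open>n\<close>
  collects the subgroups of index \<open>n\<close>.  It is meaningful when there are only
  finitely many of these, each with finitely many fixed points; see
  \<open>finite_index_subgroups_Dinf\<close> and \<open>finite_fixed_points_flip_action\<close> below.
  The index is always positive, so the coefficient at 0 vanishes and the composition with
  the exponential series is well defined.
\<close>

definition lind_zeta :: "('g, 'm) monoid_scheme \<Rightarrow> 'x set \<Rightarrow> ('g \<Rightarrow> 'x \<Rightarrow> 'x) \<Rightarrow> rat fps" where
  "lind_zeta G X \<alpha> =
     fps_exp 1 oo Abs_fps (\<lambda>n.
       \<Sum>H \<in> {H \<in> finite_index_subgroups G. card (rcosets\<^bsub>G\<^esub> H) = n}.
         of_nat (card (fixed_points X \<alpha> H)) / of_nat n)"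

text \<open>
  The action is the homomorphism from \<open>Dinf\<close> to the group of bijections of the
  shift space that sends the two generators to the shift map and to the flip map.
\<close>

definition flip_action ::
  "'a set \<Rightarrow> 'a matrix \<Rightarrow> 'a matrix \<Rightarrow> int \<times> bool \<Rightarrow> (int \<Rightarrow> 'a) \<Rightarrow> (int \<Rightarrow> 'a)" where
  "flip_action I A J = Dinf_hom (BijGroup (shift_space I A)) (shift_map I A) (flip_map I A J)"

definition lind_zeta_flip :: "'a set \<Rightarrow> 'a matrix \<Rightarrow> 'a matrix \<Rightarrow> rat fps" where
  "lind_zeta_flip I A J = lind_zeta Dinf (shift_space I A) (flip_action I A J)"


section \<open>Well-definedness\<close>

lemma flip_perm_ex1:
  assumes "flip_pair I A J" "a \<in> I"
  shows "\<exists>!b. b \<in> I \<and> J a b = 1"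
proof -
  have fin: "finite I" and z: "\<And>i j. i \<in> I \<Longrightarrow> j \<in> I \<Longrightarrow> J i j = 0 \<or> J i j = 1"
    and JJ: "\<And>i j. i \<in> I \<Longrightarrow> j \<in> I \<Longrightarrow> (\<Sum>k\<in>I. J i k * J k j) = (if i = j then 1 else 0)"
    using assms by (auto simp: flip_pair_def zero_one_mat_def mat_eq_def mat_mult_def mat_id_def)
  have sym: "J c b = 1" if "b \<in> I" "c \<in> I" "J b c = 1" for b c
  proof -
    have "(\<Sum>k\<in>I. J c k * J k c) \<noteq> 0" using JJ[of c c] that by simp
    then obtain d where d: "d \<in> I" "J c d * J d c \<noteq> 0"
      by (rule sum.not_neutral_contains_not_neutral)
    then have dc: "J c d = 1" "J d c = 1" using z that by fastforce+
    have "J b c * J c d \<noteq> 0" using dc that by simp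
    then have "(\<Sum>k\<in>I. J b k * J k d) \<noteq> 0" using member_le_sum[of c I "\<lambda>k. J b k * J k d"] fin that(2) by linarith
    then have "b = d" using JJ[of b d] that d by presburger
    then show ?thesis using dc by simp
  qed
  have "(\<Sum>k\<in>I. J a k * J k a) \<noteq> 0" using JJ[of a a] assms by simp
  then obtain b where b: "b \<in> I" "J a b * J b a \<noteq> 0"
    by (rule sum.not_neutral_contains_not_neutral)
  then have ab: "J a b = 1" "J b a = 1" using z assms by fastforce+
  show ?thesis
  proof (rule ex1I[of _ b])
    fix c assume c: "c \<in> I \<and> J a c = 1"
    then have "J b a * J a c \<noteq> 0" using ab by simp
    then have "(\<Sum>k\<in>I. J b k * J k c) \<noteq> 0" using member_le_sum[of a I "\<lambda>k. J b k * J k c"] fin assms(2) by linarith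
    then show "c = b" using JJ[of b c] b c by presburger
  qed (use b ab in simp)
qed

lemma flip_perm:
  assumes "flip_pair I A J" "a \<in> I"
  shows "flip_perm I J a \<in> I"
    and "b \<in> I \<Longrightarrow> J a b = 1 \<longleftrightarrow> flip_perm I J a = b"
    and "b \<in> I \<Longrightarrow> J a b = (if flip_perm I J a = b then 1 else 0)"
proof -
  note ex1 = flip_perm_ex1[OF assms]
  have t: "flip_perm I J a \<in> I \<and> J a (flip_perm I J a) = 1"
    unfolding flip_perm_def by (rule theI'[OF ex1])
  then show "flip_perm I J a \<in> I" by simp
  show iff: "b \<in> I \<Longrightarrow> J a b = 1 \<longleftrightarrow> flip_perm I J a = b" for b
    using t ex1 by blast
  show "J a b = (if flip_perm I J a = b then 1 else 0)" if "b \<in> I"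
    using iff[OF that] assms that by (fastforce simp: flip_pair_def zero_one_mat_def)
qed

lemma flip_perm_invol:
  assumes "flip_pair I A J" "a \<in> I"
  shows "flip_perm I J (flip_perm I J a) = a"
proof -
  let ?t = "flip_perm I J"
  have fin: "finite I" and one: "(\<Sum>k\<in>I. J a k * J k a) = 1"
    using assms by (auto simp: flip_pair_def mat_eq_def mat_mult_def mat_id_def)
  have "(\<Sum>k\<in>I. J a k * J k a) = (\<Sum>k\<in>I. if ?t a = k then J k a else 0)"
    by (rule sum.cong) (auto simp: flip_perm(3)[OF assms])
  also have "\<dots> = J (?t a) a" using fin flip_perm(1)[OF assms] by simp
  finally show ?thesis using one flip_perm(1,2)[OF assms(1)] assms by metis
qed

lemma flip_perm_adj:
  assumes fp: "flip_pair I A J" and a: "a \<in> I" and b: "b \<in> I"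
  shows "A (flip_perm I J a) b = A (flip_perm I J b) a"
proof -
  let ?t = "flip_perm I J"
  have fin: "finite I" using fp by (simp add: flip_pair_def)
  have "(\<Sum>k\<in>I. J a k * A k b) = (\<Sum>k\<in>I. if ?t a = k then A k b else 0)"
    by (rule sum.cong) (auto simp: flip_perm(3)[OF fp a])
  also have "\<dots> = A (?t a) b" using fin flip_perm(1)[OF fp a] by simp
  finally have 1: "(\<Sum>k\<in>I. J a k * A k b) = A (?t a) b" .
  have "(\<Sum>k\<in>I. A k a * J k b) = (\<Sum>k\<in>I. if ?t b = k then A k a else 0)"
  proof (rule sum.cong)
    fix k assume k: "k \<in> I"
    have "?t k = b \<longleftrightarrow> ?t b = k"
      using flip_perm_invol[OF fp b] flip_perm_invol[OF fp k] by metis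
    then show "A k a * J k b = (if ?t b = k then A k a else 0)"
      using flip_perm(3)[OF fp k b] by simp
  qed simp
  also have "\<dots> = A (?t b) a" using fin flip_perm(1)[OF fp b] by simp
  finally have 2: "(\<Sum>k\<in>I. A k a * J k b) = A (?t b) a" .
  have "(\<Sum>k\<in>I. J a k * A k b) = (\<Sum>k\<in>I. A k a * J k b)"
    using fp a b by (auto simp: flip_pair_def mat_eq_def mat_mult_def mat_transpose_def)
  then show ?thesis using 1 2 by simp
qed

lemma shift_map_Bij: "shift_map I A \<in> Bij (shift_space I A)"
proof -
  have "bij_betw (shift_map I A) (shift_space I A) (shift_space I A)"
  proof (rule bij_betw_byWitness[where f' = "\<lambda>x i. x (i - 1)"])
    show "(\<lambda>x i. x (i - 1)) ` shift_space I A \<subseteq> shift_space I A"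
    proof (clarsimp simp: shift_space_def)
      fix x :: "int \<Rightarrow> 'a" and i
      assume "\<forall>i. A (x i) (x (i + 1)) = Suc 0"
      then have "A (x (i - 1)) (x (i - 1 + 1)) = Suc 0" by blast
      then show "A (x (i - 1)) (x i) = Suc 0" by simp
    qed
    then show "\<forall>x\<in>shift_space I A. shift_map I A (\<lambda>i. x (i - 1)) = x"
      by (auto simp: shift_map_def image_subset_iff)
  qed (auto simp: shift_map_def shift_space_def)
  then show ?thesis by (simp add: Bij_def shift_map_def)
qed

lemma flip_map_in:
  assumes fp: "flip_pair I A J" and x: "x \<in> shift_space I A"
  shows "(\<lambda>i. flip_perm I J (x (- i))) \<in> shift_space I A"
proof -
  let ?t = "flip_perm I J"
  have xI: "x i \<in> I" and xA: "A (x i) (x (i + 1)) = 1" for i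
    using x by (auto simp: shift_space_def)
  have "A (?t (x (- i))) (?t (x (- (i + 1)))) = 1" for i
  proof -
    have "A (?t (x (- i))) (?t (x (- i - 1))) = A (?t (?t (x (- i - 1)))) (x (- i))"
      using flip_perm_adj[OF fp xI flip_perm(1)[OF fp xI]] .
    also have "\<dots> = 1" using flip_perm_invol[OF fp xI] xA[of "- i - 1"] by simp
    finally show ?thesis by simp
  qed
  then show ?thesis using flip_perm(1)[OF fp xI] by (auto simp: shift_space_def)
qed

lemma flip_map_invol:
  assumes fp: "flip_pair I A J" and x: "x \<in> shift_space I A"
  shows "flip_map I A J (flip_map I A J x) = x"
proof -
  have "x i \<in> I" for i using x by (simp add: shift_space_def)
  then show ?thesis using x flip_map_in[OF fp x] flip_perm_invol[OF fp] by (simp add: flip_map_def)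
qed

lemma flip_map_Bij:
  assumes fp: "flip_pair I A J"
  shows "flip_map I A J \<in> Bij (shift_space I A)"
proof -
  have "bij_betw (flip_map I A J) (shift_space I A) (shift_space I A)"
    by (rule bij_betw_byWitness[where f' = "flip_map I A J"])
       (use flip_map_invol[OF fp] flip_map_in[OF fp] in \<open>auto simp: flip_map_def\<close>)
  then show ?thesis by (simp add: Bij_def flip_map_def)
qed

lemma shift_flip_commute:
  assumes fp: "flip_pair I A J"
  shows "shift_map I A \<otimes>\<^bsub>BijGroup (shift_space I A)\<^esub> flip_map I A J =
         flip_map I A J \<otimes>\<^bsub>BijGroup (shift_space I A)\<^esub> inv\<^bsub>BijGroup (shift_space I A)\<^esub> shift_map I A"
proof -
  let ?X = "shift_space I A" and ?s = "shift_map I A" and ?f = "flip_map I A J"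
  interpret group "BijGroup ?X" by (rule group_BijGroup)
  have car: "?s \<in> carrier (BijGroup ?X)" "?f \<in> carrier (BijGroup ?X)"
    using shift_map_Bij flip_map_Bij[OF fp] by (auto simp: BijGroup_def)
  have in_s: "?s x \<in> ?X" "?f x \<in> ?X" if "x \<in> ?X" for x
    using that car Bij_imp_funcset[OF shift_map_Bij] Bij_imp_funcset[OF flip_map_Bij[OF fp]] by blast+
  have "compose ?X (compose ?X ?s ?f) ?s = ?f"
  proof
    fix x
    show "compose ?X (compose ?X ?s ?f) ?s x = ?f x"
    proof (cases "x \<in> ?X")
      case True
      have "?s (?f (?s x)) = ?f x"
        using in_s[OF True] in_s(2)[OF in_s(1)[OF True]] True
        by (auto simp: shift_map_def flip_map_def)
      then show ?thesis using True in_s[OF True] by (simp add: compose_def)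
    qed (simp add: compose_def flip_map_def)
  qed
  then have "(?s \<otimes>\<^bsub>BijGroup ?X\<^esub> ?f) \<otimes>\<^bsub>BijGroup ?X\<^esub> ?s = ?f"
    using shift_map_Bij[of I A] flip_map_Bij[OF fp] by (simp add: BijGroup_def compose_Bij)
  then show ?thesis using car by (metis inv_solve_right m_closed)
qed

lemma flip_map_square:
  assumes fp: "flip_pair I A J"
  shows "flip_map I A J \<otimes>\<^bsub>BijGroup (shift_space I A)\<^esub> flip_map I A J = \<one>\<^bsub>BijGroup (shift_space I A)\<^esub>"
proof -
  have "compose (shift_space I A) (flip_map I A J) (flip_map I A J) = (\<lambda>x\<in>shift_space I A. x)"
    unfolding compose_def by (rule restrict_ext) (rule flip_map_invol[OF fp])
  then show ?thesis using flip_map_Bij[OF fp] by (simp add: BijGroup_def)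
qed

theorem flip_action:
  assumes fp: "flip_pair I A J"
  shows "group_action Dinf (shift_space I A) (flip_action I A J)"
    and "flip_action I A J Dinf_a = shift_map I A"
    and "flip_action I A J Dinf_b = flip_map I A J"
proof -
  let ?G = "BijGroup (shift_space I A)"
  interpret group ?G by (rule group_BijGroup)
  have car: "shift_map I A \<in> carrier ?G" "flip_map I A J \<in> carrier ?G"
    using shift_map_Bij flip_map_Bij[OF fp] by (auto simp: BijGroup_def)
  show "group_action Dinf (shift_space I A) (flip_action I A J)"
    using Dinf_hom_hom[OF car shift_flip_commute[OF fp] flip_map_square[OF fp]] group_Dinf is_group
    by (simp add: group_action_def group_hom_def group_hom_axioms_def flip_action_def)
  show "flip_action I A J Dinf_a = shift_map I A" "flip_action I A J Dinf_b = flip_map I A J"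
    using car by (auto simp: flip_action_def Dinf_hom_def Dinf_a_def Dinf_b_def)
qed

lemma Dinf_translation_in_subgroup:
  assumes H: "subgroup H Dinf" and fin: "finite (rcosets\<^bsub>Dinf\<^esub> H)"
  shows "\<exists>m. 0 < m \<and> m \<le> int (card (rcosets\<^bsub>Dinf\<^esub> H)) \<and> (m, False) \<in> H"
proof -
  interpret group Dinf by (rule group_Dinf)
  interpret subgroup H Dinf by (rule H)
  let ?n = "card (rcosets\<^bsub>Dinf\<^esub> H)"
  let ?c = "\<lambda>i. H #>\<^bsub>Dinf\<^esub> (int i, False)"
  have "?c ` {0..?n} \<subseteq> rcosets\<^bsub>Dinf\<^esub> H" by (auto simp: RCOSETS_def)
  then have "card (?c ` {0..?n}) \<le> ?n" by (rule card_mono[OF fin])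
  then have "card (?c ` {0..?n}) < card {0..?n}" by simp
  then have "\<not> inj_on ?c {0..?n}" using pigeonhole by blast
  then obtain i j where ij: "i \<le> ?n" "j \<le> ?n" "i < j" "?c i = ?c j"
    unfolding inj_on_def by (metis atLeastAtMost_iff linorder_neqE_nat)
  have "(int j, False) \<in> ?c i"
    using ij(4) rcos_self[of "(int j, False)" H] H by simp
  then obtain h where h: "h \<in> H" "(int j, False) = h \<otimes>\<^bsub>Dinf\<^esub> (int i, False)"
    by (auto simp: r_coset_def)
  then have "h = (int j - int i, False)" by (cases h) (auto split: if_splits)
  then show ?thesis using h ij by (intro exI[of _ "int j - int i"]) auto
qed

theorem finite_index_subgroups_Dinf:
  "finite {H \<in> finite_index_subgroups Dinf. card (rcosets\<^bsub>Dinf\<^esub> H) = n}"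
proof -
  let ?F = "{H \<in> finite_index_subgroups Dinf. card (rcosets\<^bsub>Dinf\<^esub> H) = n}"
  define N :: int where "N = fact n"
  let ?W = "{0..<N} \<times> (UNIV :: bool set)"
  have N: "N > 0" by (simp add: N_def)
  have mem: "(k, e) \<in> H \<longleftrightarrow> (k mod N, e) \<in> H" if "H \<in> ?F" for H k e
  proof -
    have H: "subgroup H Dinf" and fin: "finite (rcosets\<^bsub>Dinf\<^esub> H)" and n: "card (rcosets\<^bsub>Dinf\<^esub> H) = n"
      using that by (auto simp: finite_index_subgroups_def)
    interpret group Dinf by (rule group_Dinf)
    obtain m where m: "0 < m" "m \<le> int n" "(m, False) \<in> H"
      using Dinf_translation_in_subgroup[OF H fin] n by auto
    have "nat m dvd fact n" using m by (intro dvd_fact) auto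
    then have "int (nat m) dvd int (fact n)" by (simp only: int_dvd_int_iff)
    then have "m dvd N" using m by (simp add: N_def)
    then obtain q where q: "N = m * q" by blast
    have tr: "(N * r, False) \<in> H" for r
    proof -
      have "(m, False) [^]\<^bsub>Dinf\<^esub> (q * r) \<in> H"
        using H m(3) by (rule subgroup_int_pow_closed)
      then show ?thesis by (simp add: Dinf_int_pow q mult_ac)
    qed
    have step: "(N * r + k, e) \<in> H" if "(k, e) \<in> H" for r k
      using subgroup.m_closed[OF H tr[of r] that] by simp
    show ?thesis
      using step[of k "- (k div N)"] step[of "k mod N" "k div N"]
      by (auto simp: minus_div_mult_eq_mod[symmetric] algebra_simps)
  qed
  have "inj_on (\<lambda>H. H \<inter> ?W) ?F"
  proof (rule inj_onI)
    fix H H' assume HH: "H \<in> ?F" "H' \<in> ?F" "H \<inter> ?W = H' \<inter> ?W"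
    have "(k, e) \<in> H \<longleftrightarrow> (k, e) \<in> H'" for k e
    proof -
      have "(k mod N, e) \<in> ?W" using N by simp
      then have "(k mod N, e) \<in> H \<longleftrightarrow> (k mod N, e) \<in> H'" using HH(3) by blast
      then show ?thesis using mem[OF HH(1)] mem[OF HH(2)] by metis
    qed
    then show "H = H'" by auto
  qed
  moreover have "(\<lambda>H. H \<inter> ?W) ` ?F \<subseteq> Pow ?W" by blast
  then have "finite ((\<lambda>H. H \<inter> ?W) ` ?F)" by (rule finite_subset) simp
  ultimately show ?thesis using finite_imageD by blast
qed

lemma flip_action_translation:
  assumes fp: "flip_pair I A J" and x: "x \<in> shift_space I A"
  shows "flip_action I A J (int n, False) x = (\<lambda>i. x (i + int n))"
proof (induction n)
  case 0
  interpret group_action Dinf "shift_space I A" "flip_action I A J" by (rule flip_action(1)[OF fp])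
  show ?case using id_eq_one x by (metis Dinf_simps(3) of_nat_0 add_0_right restrict_apply')
next
  case (Suc n)
  interpret group_action Dinf "shift_space I A" "flip_action I A J" by (rule flip_action(1)[OF fp])
  have g: "(int (Suc n), False) = Dinf_a \<otimes>\<^bsub>Dinf\<^esub> (int n, False)" by (simp add: Dinf_a_def)
  have "flip_action I A J (int (Suc n), False) x =
        shift_map I A (flip_action I A J (int n, False) x)"
    unfolding g using composition_rule[OF x, of Dinf_a "(int n, False)"] flip_action(2)[OF fp] by simp
  moreover have "flip_action I A J (int n, False) x \<in> shift_space I A"
    using element_image[OF _ x] by simp
  ultimately show ?case using Suc by (simp add: shift_map_def algebra_simps)
qed

theorem finite_fixed_points_flip_action:
  assumes fp: "flip_pair I A J" and H: "H \<in> finite_index_subgroups Dinf"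
  shows "finite (fixed_points (shift_space I A) (flip_action I A J) H)"
proof -
  let ?P = "fixed_points (shift_space I A) (flip_action I A J) H"
  obtain m where m: "0 < m" "(m, False) \<in> H"
    using Dinf_translation_in_subgroup H by (auto simp: finite_index_subgroups_def)
  define n where "n = nat m"
  have n: "m = int n" "n > 0" using m by (auto simp: n_def)
  let ?r = "\<lambda>x::int \<Rightarrow> 'a. restrict x {0..<m}"
  have per: "x (i + m) = x i" if "x \<in> ?P" for x i
  proof -
    have "flip_action I A J (m, False) x = x" using that m by (auto simp: fixed_points_def)
    moreover have "flip_action I A J (m, False) x = (\<lambda>i. x (i + m))"
      using flip_action_translation[OF fp, of x n] that n by (simp add: fixed_points_def)
    ultimately show ?thesis by metis
  qed
  have per_nat: "x (i + int k * m) = x i" if "x \<in> ?P" for x i k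
  proof (induction k)
    case (Suc k)
    have "x (i + int (Suc k) * m) = x (i + int k * m + m)" by (simp add: algebra_simps)
    then show ?case using Suc per[OF that] by simp
  qed simp
  have permod: "x i = x (i mod m)" if "x \<in> ?P" for x i
  proof (cases "0 \<le> i div m")
    case True
    then show ?thesis using per_nat[OF that, of "i mod m" "nat (i div m)"] by simp
  next
    case False
    have "i + int (nat (- (i div m))) * m = i mod m"
      using False by (simp add: minus_div_mult_eq_mod[symmetric])
    then show ?thesis using per_nat[OF that, of i "nat (- (i div m))"] by simp
  qed
  have "inj_on ?r ?P"
  proof (rule inj_onI)
    fix x y assume xy: "x \<in> ?P" "y \<in> ?P" "?r x = ?r y"
    have "x i = y i" for i
    proof -
      have "i mod m \<in> {0..<m}" using m by simp
      then have "x (i mod m) = y (i mod m)" using xy(3) by (metis restrict_apply')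
      then show ?thesis using permod[OF xy(1)] permod[OF xy(2)] by metis
    qed
    then show "x = y" by blast
  qed
  moreover have "?r ` ?P \<subseteq> {0..<m} \<rightarrow>\<^sub>E I"
    by (auto simp: fixed_points_def shift_space_def)
  then have "finite (?r ` ?P)"
    by (rule finite_subset) (use fp in \<open>auto simp: flip_pair_def intro: finite_PiE\<close>)
  ultimately show ?thesis using finite_imageD by blast
qed

end

theory Submission
  imports Defs
begin

text \<open>
  A half elementary equivalence \<open>(R, S)\<close> recodes \<open>x\<close> as the sequence of intermediate symbols
  \<open>y\<^sub>i\<close> with \<open>R(x\<^sub>i, y\<^sub>i) = S(y\<^sub>i, x\<^sub>i\<^sub>+\<^sub>1) = 1\<close>.  Recoding back with \<open>(S, R)\<close> gives the shift, so this is a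
  bijection.  It commutes with the shifts, but since \<open>y\<^sub>i\<close> lies halfway between \<open>x\<^sub>i\<close> and \<open>x\<^sub>i\<^sub>+\<^sub>1\<close> it
  carries the flip \<open>\<phi>\<close> of the first system to \<open>\<sigma> \<circ> \<phi>\<close> in the second.  The two actions of the
  dihedral group are therefore conjugate only up to the automorphism \<open>a \<mapsto> a\<close>, \<open>b \<mapsto> ab\<close>.  This
  automorphism permutes the subgroups of each finite index, so the Lind zeta function does not change.
\<close>

section \<open>Invariance of the Lind zeta function\<close>

lemma iso_image_rcosets:
  assumes "group G" "group G'" and \<psi>: "\<psi> \<in> iso G G'" and H: "subgroup H G"
  shows "rcosets\<^bsub>G'\<^esub> (\<psi> ` H) = (`) \<psi> ` (rcosets\<^bsub>G\<^esub> H)"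
proof -
  have hom: "\<psi> (x \<otimes>\<^bsub>G\<^esub> y) = \<psi> x \<otimes>\<^bsub>G'\<^esub> \<psi> y" if "x \<in> carrier G" "y \<in> carrier G" for x y
    using \<psi> that by (auto simp: iso_def hom_def)
  have surj: "carrier G' = \<psi> ` carrier G"
    using \<psi> by (auto simp: iso_def bij_betw_def)
  have coset: "(\<psi> ` H) #>\<^bsub>G'\<^esub> \<psi> g = \<psi> ` (H #>\<^bsub>G\<^esub> g)" if "g \<in> carrier G" for g
  proof -
    have "\<psi> (h \<otimes>\<^bsub>G\<^esub> g) = \<psi> h \<otimes>\<^bsub>G'\<^esub> \<psi> g" if "h \<in> H" for h
      using hom subgroup.subset[OF H] that \<open>g \<in> carrier G\<close> by blast
    then show ?thesis unfolding r_coset_def by (force simp: image_UN)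
  qed
  show ?thesis
    unfolding RCOSETS_def surj using coset by auto
qed

text \<open>Cosets are subsets of the carrier, where taking images under an injective map is itself
  injective. Finiteness is a separate clause because \<open>card\<close> is 0 on every infinite
  set.\<close>

lemma iso_image_index:
  assumes G: "group G" and G': "group G'" and \<psi>: "\<psi> \<in> iso G G'" and H: "subgroup H G"
  shows "card (rcosets\<^bsub>G'\<^esub> (\<psi> ` H)) = card (rcosets\<^bsub>G\<^esub> H)"
    and "finite (rcosets\<^bsub>G'\<^esub> (\<psi> ` H)) \<longleftrightarrow> finite (rcosets\<^bsub>G\<^esub> H)"
proof -
  have "rcosets\<^bsub>G\<^esub> H \<subseteq> Pow (carrier G)"
    using group.rcosets_subset_PowG[OF G H] .
  moreover have "inj_on \<psi> (carrier G)"
    using \<psi> by (simp add: iso_def bij_betw_def)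
  ultimately have "inj_on ((`) \<psi>) (rcosets\<^bsub>G\<^esub> H)"
    by (meson inj_on_image_Pow inj_on_subset)
  then show "card (rcosets\<^bsub>G'\<^esub> (\<psi> ` H)) = card (rcosets\<^bsub>G\<^esub> H)"
    and "finite (rcosets\<^bsub>G'\<^esub> (\<psi> ` H)) \<longleftrightarrow> finite (rcosets\<^bsub>G\<^esub> H)"
    unfolding iso_image_rcosets[OF assms] by (simp_all add: card_image finite_image_iff)
qed

lemma iso_image_finite_index_subgroups:
  assumes G: "group G" and G': "group G'" and \<psi>: "\<psi> \<in> iso G G'"
    and H: "H \<in> finite_index_subgroups G"
  shows "\<psi> ` H \<in> finite_index_subgroups G'"
proof -
  interpret group_hom G G' \<psi>
    using G G' \<psi> by (simp add: group_hom_def group_hom_axioms_def iso_def)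
  show ?thesis
    using H subgroup_img_is_subgroup iso_image_index(2)[OF G G' \<psi>]
    by (auto simp: finite_index_subgroups_def)
qed

text \<open>This is the reindexing of the subgroups contributing to the coefficient at
  \<open>n\<close>; images under the inverse isomorphism undo it.\<close>

lemma bij_betw_iso_image_index:
  assumes G: "group G" and G': "group G'" and \<psi>: "\<psi> \<in> iso G G'"
  shows "bij_betw ((`) \<psi>) {H \<in> finite_index_subgroups G. card (rcosets\<^bsub>G\<^esub> H) = n}
    {H \<in> finite_index_subgroups G'. card (rcosets\<^bsub>G'\<^esub> H) = n}"
proof -
  let ?\<theta> = "inv_into (carrier G) \<psi>"
  have \<theta>: "?\<theta> \<in> iso G' G" by (rule group.iso_set_sym[OF G \<psi>])
  have bij: "bij_betw \<psi> (carrier G) (carrier G')" using \<psi> by (simp add: iso_def)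
  have sub: "H \<in> finite_index_subgroups G \<Longrightarrow> H \<subseteq> carrier G"
    "H' \<in> finite_index_subgroups G' \<Longrightarrow> H' \<subseteq> carrier G'" for H H'
    by (auto simp: finite_index_subgroups_def dest: subgroup.subset)
  have left: "?\<theta> ` \<psi> ` H = H" if "H \<in> finite_index_subgroups G" for H
    by (rule inv_into_image_cancel[OF bij_betw_imp_inj_on[OF bij] sub(1)[OF that]])
  have right: "\<psi> ` ?\<theta> ` H = H" if "H \<in> finite_index_subgroups G'" for H
    by (rule image_inv_into_cancel[OF bij_betw_imp_surj_on[OF bij] sub(2)[OF that]])
  have index: "card (rcosets\<^bsub>G'\<^esub> (\<psi> ` H)) = card (rcosets\<^bsub>G\<^esub> H)"
    if "H \<in> finite_index_subgroups G" for H
    using iso_image_index(1)[OF G G' \<psi>] that by (simp add: finite_index_subgroups_def)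
  have index': "card (rcosets\<^bsub>G\<^esub> (?\<theta> ` H)) = card (rcosets\<^bsub>G'\<^esub> H)"
    if "H \<in> finite_index_subgroups G'" for H
    using iso_image_index(1)[OF G' G \<theta>] that by (simp add: finite_index_subgroups_def)
  show ?thesis
  proof (rule bij_betw_byWitness[where f' = "(`) ?\<theta>"])
    show "(`) \<psi> ` {H \<in> finite_index_subgroups G. card (rcosets\<^bsub>G\<^esub> H) = n}
        \<subseteq> {H \<in> finite_index_subgroups G'. card (rcosets\<^bsub>G'\<^esub> H) = n}"
      using iso_image_finite_index_subgroups[OF G G' \<psi>] index by blast
    show "(`) ?\<theta> ` {H \<in> finite_index_subgroups G'. card (rcosets\<^bsub>G'\<^esub> H) = n}
        \<subseteq> {H \<in> finite_index_subgroups G. card (rcosets\<^bsub>G\<^esub> H) = n}"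
      using iso_image_finite_index_subgroups[OF G' G \<theta>] index' by blast
  qed (use left right in blast)+
qed

text \<open>The map \<open>f\<close> carries the points fixed by \<open>H\<close> onto those fixed
  by the image of \<open>H\<close> under \<psi>, so the exponents agree coefficient by
  coefficient.\<close>

theorem lind_zeta_conjugate:
  assumes \<alpha>: "group_action G X \<alpha>" and G': "group G'"
    and \<psi>: "\<psi> \<in> iso G G'" and f: "bij_betw f X Y"
    and equiv: "\<And>g x. g \<in> carrier G \<Longrightarrow> x \<in> X \<Longrightarrow> f (\<alpha> g x) = \<beta> (\<psi> g) (f x)"
  shows "lind_zeta G X \<alpha> = lind_zeta G' Y \<beta>"
proof -
  interpret \<alpha>: group_action G X \<alpha> by (rule \<alpha>)
  have G: "group G" by (rule group_hom.axioms(1)[OF \<alpha>.group_hom])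
  have fix_card: "card (fixed_points Y \<beta> (\<psi> ` H)) = card (fixed_points X \<alpha> H)"
    if "H \<subseteq> carrier G" for H
  proof -
    have "\<beta> (\<psi> h) (f x) = f x \<longleftrightarrow> \<alpha> h x = x" if "h \<in> H" "x \<in> X" for h x
    proof -
      have "h \<in> carrier G" using that \<open>H \<subseteq> carrier G\<close> by blast
      then show ?thesis
        using equiv[of h x] that \<alpha>.element_image[of h x] inj_on_eq_iff[OF bij_betw_imp_inj_on[OF f]]
        by metis
    qed
    then have "fixed_points Y \<beta> (\<psi> ` H) = f ` fixed_points X \<alpha> H"
      unfolding bij_betw_imp_surj_on[OF f, symmetric] fixed_points_def by auto
    moreover have "inj_on f (fixed_points X \<alpha> H)"
      by (rule inj_on_subset[OF bij_betw_imp_inj_on[OF f]]) (auto simp: fixed_points_def)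
    ultimately show ?thesis by (simp add: card_image)
  qed
  have "(\<Sum>H \<in> {H \<in> finite_index_subgroups G. card (rcosets\<^bsub>G\<^esub> H) = n}.
          of_nat (card (fixed_points X \<alpha> H)) / of_nat n) =
        (\<Sum>H \<in> {H \<in> finite_index_subgroups G'. card (rcosets\<^bsub>G'\<^esub> H) = n}.
          (of_nat (card (fixed_points Y \<beta> H)) / of_nat n :: rat))" (is "sum ?u ?P = sum ?v ?Q") for n
  proof -
    have "sum ?u ?P = (\<Sum>H\<in>?P. ?v (\<psi> ` H))"
      by (rule sum.cong) (simp_all add: fix_card finite_index_subgroups_def subgroup.subset)
    also have "\<dots> = sum ?v ?Q"
      by (rule sum.reindex_bij_betw[OF bij_betw_iso_image_index[OF G G' \<psi>]])
    finally show ?thesis .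
  qed
  then show ?thesis by (simp add: lind_zeta_def)
qed

section \<open>Equivariance checked on generators\<close>

text \<open>Once the elements intertwined by \<open>f\<close> are known to form a subgroup,
  equivariance has to be verified on generators only.\<close>

lemma subgroup_equivariant:
  assumes \<alpha>: "group_action G X \<alpha>" and \<beta>: "group_action G' Y \<beta>"
    and \<psi>: "\<psi> \<in> hom G G'" and f: "f \<in> X \<rightarrow> Y"
  shows "subgroup {g \<in> carrier G. \<forall>x\<in>X. f (\<alpha> g x) = \<beta> (\<psi> g) (f x)} G"
proof -
  interpret \<alpha>: group_action G X \<alpha> by (rule \<alpha>)
  interpret \<beta>: group_action G' Y \<beta> by (rule \<beta>)
  interpret G: group G by (rule group_hom.axioms(1)[OF \<alpha>.group_hom])
  interpret \<psi>: group_hom G G' \<psi>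
    using \<psi> group_hom.axioms(1)[OF \<beta>.group_hom] G.is_group
    by (simp add: group_hom_def group_hom_axioms_def)
  have fY: "f x \<in> Y" if "x \<in> X" for x using f that by blast
  show ?thesis
  proof (rule G.subgroupI)
    have "f (\<alpha> \<one>\<^bsub>G\<^esub> x) = \<beta> (\<psi> \<one>\<^bsub>G\<^esub>) (f x)" if "x \<in> X" for x
      using that fY[OF that] \<alpha>.id_eq_one \<beta>.id_eq_one \<psi>.hom_one by (metis restrict_apply')
    then show "{g \<in> carrier G. \<forall>x\<in>X. f (\<alpha> g x) = \<beta> (\<psi> g) (f x)} \<noteq> {}" by blast
  next
    fix g assume "g \<in> {g \<in> carrier G. \<forall>x\<in>X. f (\<alpha> g x) = \<beta> (\<psi> g) (f x)}"
    then have g: "g \<in> carrier G" and eq: "\<And>x. x \<in> X \<Longrightarrow> f (\<alpha> g x) = \<beta> (\<psi> g) (f x)" by auto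
    have "f (\<alpha> (inv\<^bsub>G\<^esub> g) x) = \<beta> (\<psi> (inv\<^bsub>G\<^esub> g)) (f x)" if x: "x \<in> X" for x
    proof -
      \<comment> \<open>Equivariance of \<open>g\<close> is applied at the point that
        \<open>g\<close> sends to \<open>x\<close>; inverting the action of \<open>\<psi> g\<close>
        then gives the claim for the inverse.\<close>
      let ?z = "\<alpha> (inv\<^bsub>G\<^esub> g) x"
      have z: "?z \<in> X" using \<alpha>.element_image[of "inv\<^bsub>G\<^esub> g" x] g x by simp
      have "\<alpha> g ?z = x" using \<alpha>.orbit_sym_aux[of "inv\<^bsub>G\<^esub> g" x ?z] g x by simp
      then have "\<beta> (\<psi> g) (f ?z) = f x" using eq[OF z] by simp
      then have "\<beta> (inv\<^bsub>G'\<^esub> (\<psi> g)) (f x) = f ?z"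
        using \<beta>.orbit_sym_aux[of "\<psi> g" "f ?z" "f x"] fY[OF z] g by simp
      then show ?thesis using g by simp
    qed
    then show "inv\<^bsub>G\<^esub> g \<in> {g \<in> carrier G. \<forall>x\<in>X. f (\<alpha> g x) = \<beta> (\<psi> g) (f x)}" using g by simp
  next
    fix g h
    assume "g \<in> {g \<in> carrier G. \<forall>x\<in>X. f (\<alpha> g x) = \<beta> (\<psi> g) (f x)}"
      and "h \<in> {g \<in> carrier G. \<forall>x\<in>X. f (\<alpha> g x) = \<beta> (\<psi> g) (f x)}"
    then show "g \<otimes>\<^bsub>G\<^esub> h \<in> {g \<in> carrier G. \<forall>x\<in>X. f (\<alpha> g x) = \<beta> (\<psi> g) (f x)}"
      using \<alpha>.element_image[of h] by (auto simp: \<alpha>.composition_rule \<beta>.composition_rule fY)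
  qed auto
qed

lemma Dinf_subgroup_UNIV:
  assumes H: "subgroup H Dinf" and "Dinf_a \<in> H" "Dinf_b \<in> H"
  shows "H = UNIV"
proof -
  interpret group Dinf by (rule group_Dinf)
  have "(k, e) \<in> H" for k e
    unfolding Dinf_normal_form[of k e]
    using assms subgroup_int_pow_closed[OF H, of Dinf_a k] subgroup.one_closed[OF H]
    by (auto intro!: subgroup.m_closed[OF H] simp del: Dinf_simps)
  then show ?thesis by auto
qed

text \<open>This is the automorphism fixing \<open>a\<close> and sending \<open>b\<close> to
  \<open>ab\<close>, in normal forms: \<open>a^k b\<close> becomes \<open>a^k (a b)\<close>, hence
  the \<open>k + 1\<close>.\<close>

definition Dinf_twist :: "int \<times> bool \<Rightarrow> int \<times> bool" where
  "Dinf_twist = (\<lambda>(k, e). (if e then k + 1 else k, e))"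

lemma Dinf_twist_generators:
  "Dinf_twist Dinf_a = Dinf_a" "Dinf_twist Dinf_b = Dinf_a \<otimes>\<^bsub>Dinf\<^esub> Dinf_b"
  by (simp_all add: Dinf_twist_def Dinf_a_def Dinf_b_def)

lemma Dinf_twist_iso: "Dinf_twist \<in> iso Dinf Dinf"
proof -
  have "bij_betw Dinf_twist UNIV UNIV"
    by (rule bij_betw_byWitness[where f' = "\<lambda>(k, e). (if e then k - 1 else k, e)"])
      (auto simp: Dinf_twist_def)
  then show ?thesis by (auto simp: iso_def hom_def Dinf_twist_def)
qed

section \<open>Recoding by intermediate symbols\<close>

text \<open>The description is meaningful on points of the shift space, where
  \<open>intermediate_ex1\<close> provides existence and uniqueness.\<close>

definition recode :: "'a set \<Rightarrow> 'a matrix \<Rightarrow> 'a matrix \<Rightarrow> (int \<Rightarrow> 'a) \<Rightarrow> (int \<Rightarrow> 'a)" where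
  "recode I' R S x = (\<lambda>i. THE b. b \<in> I' \<and> R (x i) b = 1 \<and> S b (x (i + 1)) = 1)"

text \<open>The assumptions are symmetric in \<open>(I, A, R)\<close> and \<open>(I', B, S)\<close>,
  so through \<open>swap\<close> each lemma also serves for recoding in the opposite
  direction.\<close>

locale elementary_equivalence =
  fixes I I' :: "'a set" and A B R S :: "'a matrix"
  assumes finite: "finite I" "finite I'"
    and zero_one: "zero_one_mat I I A" "zero_one_mat I' I' B"
    and A_eq: "mat_eq I I A (mat_mult I' R S)"
    and B_eq: "mat_eq I' I' B (mat_mult I S R)"
begin

lemma swap: "elementary_equivalence I' I B A S R"
  by (rule elementary_equivalence.intro) (fact finite zero_one A_eq B_eq)+

text \<open>An entry 1 of \<open>A = RS\<close> is a sum of natural numbers equal to 1, so exactly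
  one summand is 1 and all others vanish.\<close>

lemma intermediate_ex1:
  assumes "a \<in> I" "a' \<in> I" "A a a' = 1"
  shows "\<exists>!b. b \<in> I' \<and> R a b = 1 \<and> S b a' = 1"
proof -
  have "(\<Sum>b\<in>I'. R a b * S b a') = 1"
    using assms A_eq by (simp add: mat_eq_def mat_mult_def)
  then obtain b where b: "b \<in> I'" "R a b * S b a' = 1"
    and other: "\<forall>c\<in>I'. b \<noteq> c \<longrightarrow> R a c * S c a' = 0"
    unfolding sum_eq_1_iff[OF finite(2)] by auto
  show ?thesis
  proof (rule ex1I[of _ b])
    show "b \<in> I' \<and> R a b = 1 \<and> S b a' = 1" using b by simp
    show "c = b" if "c \<in> I' \<and> R a c = 1 \<and> S c a' = 1" for c
      using other that by fastforce
  qed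
qed

lemma recode:
  assumes "x \<in> shift_space I A"
  shows "recode I' R S x i \<in> I'" "R (x i) (recode I' R S x i) = 1"
    "S (recode I' R S x i) (x (i + 1)) = 1"
proof -
  have "recode I' R S x i \<in> I' \<and> R (x i) (recode I' R S x i) = 1 \<and> S (recode I' R S x i) (x (i + 1)) = 1"
    unfolding recode_def
    by (rule theI'[OF intermediate_ex1]) (use assms in \<open>auto simp: shift_space_def\<close>)
  then show "recode I' R S x i \<in> I'" "R (x i) (recode I' R S x i) = 1"
    "S (recode I' R S x i) (x (i + 1)) = 1"
    by auto
qed

lemma recode_eqI:
  assumes "x \<in> shift_space I A" "\<And>i. y i \<in> I'" "\<And>i. R (x i) (y i) = 1" "\<And>i. S (y i) (x (i + 1)) = 1"
  shows "recode I' R S x = y"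
proof
  fix i
  have "x i \<in> I" "x (i + 1) \<in> I" "A (x i) (x (i + 1)) = 1"
    using assms(1) by (auto simp: shift_space_def)
  then show "recode I' R S x i = y i"
    using intermediate_ex1 recode[OF assms(1), of i] assms(2-4) by blast
qed

text \<open>The symbol \<open>x (i + 1)\<close> links the i-th and the next recoded symbol, so the
  entry of \<open>B = SR\<close> is nonzero; being zero or one, it is 1.\<close>

lemma recode_in:
  assumes x: "x \<in> shift_space I A"
  shows "recode I' R S x \<in> shift_space I' B"
proof -
  let ?y = "recode I' R S x"
  have "B (?y i) (?y (i + 1)) = 1" for i
  proof -
    have "S (?y i) (x (i + 1)) * R (x (i + 1)) (?y (i + 1)) = 1"
      using recode[OF x] by simp
    moreover have "x (i + 1) \<in> I" using x by (simp add: shift_space_def)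
    ultimately have "(\<Sum>a\<in>I. S (?y i) a * R a (?y (i + 1))) \<noteq> 0"
      using finite(1) by (auto simp: sum_eq_0_iff intro!: bexI[of _ "x (i + 1)"])
    then have "B (?y i) (?y (i + 1)) \<noteq> 0"
      using B_eq recode(1)[OF x] by (simp add: mat_eq_def mat_mult_def)
    moreover have "B (?y i) (?y (i + 1)) \<in> {0, 1}"
      using zero_one(2) recode(1)[OF x] by (simp add: zero_one_mat_def)
    ultimately show ?thesis by simp
  qed
  then show ?thesis using recode(1)[OF x] by (simp add: shift_space_def)
qed

text \<open>The symbol between the recoded symbols at \<open>i\<close> and \<open>i + 1\<close> is
  \<open>x (i + 1)\<close>, which is why the round trip is the shift and not the identity.\<close>

lemma recode_recode:
  assumes x: "x \<in> shift_space I A"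
  shows "recode I S R (recode I' R S x) = (\<lambda>i. x (i + 1))"
  by (rule elementary_equivalence.recode_eqI[OF swap recode_in[OF x]])
    (use x recode[OF x] in \<open>auto simp: shift_space_def\<close>)

lemma recode_shift:
  assumes x: "x \<in> shift_space I A"
  shows "recode I' R S (shift_map I A x) = shift_map I' B (recode I' R S x)"
  using x recode_in[OF x] by (simp add: shift_map_def recode_def)

lemma recode_bij: "bij_betw (recode I' R S) (shift_space I A) (shift_space I' B)"
proof (rule bij_betw_imageI)
  show "inj_on (recode I' R S) (shift_space I A)"
  proof (rule inj_onI)
    fix x x' assume x: "x \<in> shift_space I A" "x' \<in> shift_space I A"
      and "recode I' R S x = recode I' R S x'"
    then have "(\<lambda>i. x (i + 1)) = (\<lambda>i. x' (i + 1))" using recode_recode by metis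
    then have "x (i - 1 + 1) = x' (i - 1 + 1)" for i by meson
    then show "x = x'" by auto
  qed
  show "recode I' R S ` shift_space I A = shift_space I' B"
  proof (rule subset_antisym)
    show "shift_space I' B \<subseteq> recode I' R S ` shift_space I A"
    proof
      fix y assume "y \<in> shift_space I' B"
      \<comment> \<open>Starting from the shift preimage of \<open>y\<close> compensates for the
        shift that the round trip introduces.\<close>
      then obtain z where z: "z \<in> shift_space I' B" "y = shift_map I' B z"
        using shift_map_Bij[of I' B] by (auto simp: Bij_def bij_betw_def)
      have "y = recode I' R S (recode I S R z)"
        using elementary_equivalence.recode_recode[OF swap z(1)] z by (simp add: shift_map_def)
      then show "y \<in> recode I' R S ` shift_space I A"
        using elementary_equivalence.recode_in[OF swap z(1)] by blast
    qed
  qed (use recode_in in blast)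
qed

end

section \<open>Compatibility of the recoding with the flips\<close>

text \<open>\<open>J\<close> and \<open>K\<close> are the permutation matrices of involutions, so
  each sum in the product of \<open>K\<close>, the transpose of \<open>R\<close> and
  \<open>J\<close> collapses to one term.\<close>

lemma half_elementary_equivalence_flip:
  assumes A: "flip_pair I A J" and B: "flip_pair I' B K"
    and RS: "half_elementary_equivalence I A J I' B K R S" and a: "a \<in> I" and b: "b \<in> I'"
  shows "S b a = R (flip_perm I J a) (flip_perm I' K b)"
proof -
  let ?s = "flip_perm I J" and ?t = "flip_perm I' K"
  have fin: "finite I" "finite I'" using A B by (auto simp: flip_pair_def)
  have KR: "(\<Sum>l\<in>I'. K b l * R k l) = R k (?t b)" for k
  proof -
    have "(\<Sum>l\<in>I'. K b l * R k l) = (\<Sum>l\<in>I'. if ?t b = l then R k l else 0)"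
      by (rule sum.cong) (auto simp: flip_perm(3)[OF B b])
    then show ?thesis using fin flip_perm(1)[OF B b] by simp
  qed
  have "S b a = (\<Sum>k\<in>I. (\<Sum>l\<in>I'. K b l * R k l) * J k a)"
    using RS a b
    by (simp add: half_elementary_equivalence_def mat_eq_def mat_mult_def mat_transpose_def)
  also have "\<dots> = (\<Sum>k\<in>I. if ?s a = k then R k (?t b) else 0)"
  proof (rule sum.cong)
    fix k assume k: "k \<in> I"
    have "?s k = a \<longleftrightarrow> ?s a = k"
      using flip_perm_invol[OF A a] flip_perm_invol[OF A k] by metis
    then show "(\<Sum>l\<in>I'. K b l * R k l) * J k a = (if ?s a = k then R k (?t b) else 0)"
      using flip_perm(3)[OF A k a] KR by simp
  qed simp
  also have "\<dots> = R (?s a) (?t b)" using fin flip_perm(1)[OF A a] by simp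
  finally show ?thesis .
qed

theorem half_elementary_equivalence_lind_zeta:
  assumes A: "flip_pair I A J" and B: "flip_pair I' B K"
    and RS: "half_elementary_equivalence I A J I' B K R S"
  shows "lind_zeta_flip I A J = lind_zeta_flip I' B K"
proof -
  interpret elementary_equivalence I I' A B R S
    using A B RS
    by (simp add: elementary_equivalence_def flip_pair_def half_elementary_equivalence_def)
  interpret \<beta>: group_action Dinf "shift_space I' B" "flip_action I' B K"
    by (rule flip_action(1)[OF B])
  let ?X = "shift_space I A" and ?f = "recode I' R S"
  let ?s = "flip_perm I J" and ?t = "flip_perm I' K"
  let ?\<alpha> = "flip_action I A J" and ?\<beta> = "flip_action I' B K"
  note S_eq = half_elementary_equivalence_flip[OF A B RS]
  have flip: "?f (flip_map I A J x) = shift_map I' B (flip_map I' B K (?f x))"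
    if x: "x \<in> ?X" for x
  proof -
    let ?y = "?f x"
    have xI: "x i \<in> I" for i using x by (simp add: shift_space_def)
    note y = recode[OF x]
    \<comment> \<open>The flipped point has entries coming from \<open>x (- i)\<close> and
      \<open>x (- i - 1)\<close> at \<open>i\<close> and \<open>i + 1\<close>. The symbol between
      these two is \<open>?y (- i - 1)\<close>, and the offset from \<open>- i\<close> is the extra
      shift. Reversal exchanges the conditions on \<open>R\<close> and \<open>S\<close>, as
      \<open>S_eq\<close> permits.\<close>
    have "?f (\<lambda>i. ?s (x (- i))) = (\<lambda>i. ?t (?y (- (i + 1))))"
    proof (rule recode_eqI[OF flip_map_in[OF A x]])
      fix i
      show "?t (?y (- (i + 1))) \<in> I'" by (rule flip_perm(1)[OF B y(1)])
      show "R (?s (x (- i))) (?t (?y (- (i + 1)))) = 1"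
        using S_eq[OF xI[of "- i"] y(1)[of "- (i + 1)"]] y(3)[of "- (i + 1)"] by simp
      show "S (?t (?y (- (i + 1)))) (?s (x (- (i + 1)))) = 1"
        using S_eq[OF flip_perm(1)[OF A xI[of "- (i + 1)"]] flip_perm(1)[OF B y(1)[of "- (i + 1)"]]]
          y(2)[of "- (i + 1)"] flip_perm_invol[OF A xI] flip_perm_invol[OF B y(1)] by simp
    qed
    then show ?thesis
      using x recode_in[OF x] flip_map_in[OF B recode_in[OF x]]
      by (simp add: flip_map_def shift_map_def)
  qed
  \<comment> \<open>The elements intertwined up to the twist: \<open>a\<close> belongs by
    \<open>recode_shift\<close>, and \<open>b\<close> by \<open>flip\<close>, whose right-hand side
    is the action of \<open>ab\<close>.\<close>
  let ?H = "{g \<in> carrier Dinf. \<forall>x\<in>?X. ?f (?\<alpha> g x) = ?\<beta> (Dinf_twist g) (?f x)}"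
  have "?H = UNIV"
  proof (rule Dinf_subgroup_UNIV)
    show "subgroup ?H Dinf"
      using Dinf_twist_iso recode_in
      by (intro subgroup_equivariant[OF flip_action(1)[OF A] flip_action(1)[OF B]]) (auto simp: iso_def)
    show "Dinf_a \<in> ?H"
      by (simp add: Dinf_twist_generators flip_action[OF A] flip_action[OF B] recode_shift)
    show "Dinf_b \<in> ?H"
      by (simp add: Dinf_twist_generators flip_action[OF A] flip_action[OF B] flip
          \<beta>.composition_rule recode_in)
  qed
  then show ?thesis
    unfolding lind_zeta_flip_def
    by (intro lind_zeta_conjugate[OF flip_action(1)[OF A] group_Dinf Dinf_twist_iso recode_bij])
      (auto simp: set_eq_iff)
qed

theorem corollary4p2:
  fixes I I' :: "'a set" and A J B K :: "'a matrix"
  assumes "flip_pair I A J" and "flip_pair I' B K"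
    and "\<exists>l>0. Dinf_strong_shift_equivalence l I A J I' B K"
  shows "lind_zeta_flip I A J = lind_zeta_flip I' B K"
proof -
  obtain l and Is :: "nat \<Rightarrow> 'a set" and As Js Rs Ss :: "nat \<Rightarrow> 'a matrix" where
    fp: "\<And>i. i \<in> {1..l + 1} \<Longrightarrow> flip_pair (Is i) (As i) (Js i)"
    and ends: "Is 1 = I" "As 1 = A" "Js 1 = J" "Is (l + 1) = I'" "As (l + 1) = B" "Js (l + 1) = K"
    and half: "\<And>i. i \<in> {1..l} \<Longrightarrow> half_elementary_equivalence
      (Is i) (As i) (Js i) (Is (i + 1)) (As (i + 1)) (Js (i + 1)) (Rs i) (Ss i)"
    using assms(3) unfolding Dinf_strong_shift_equivalence_def by blast
  \<comment> \<open>The chain is numbered from 1, so \<open>k\<close> half elementary equivalences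
    lead to the flip pair with index \<open>k + 1\<close>.\<close>
  have "lind_zeta_flip I A J = lind_zeta_flip (Is (k + 1)) (As (k + 1)) (Js (k + 1))" if "k \<le> l" for k
    using that
  proof (induction k)
    case 0
    then show ?case by (simp only: add_0 ends)
  next
    case (Suc k)
    have "lind_zeta_flip (Is (k + 1)) (As (k + 1)) (Js (k + 1)) =
      lind_zeta_flip (Is (k + 1 + 1)) (As (k + 1 + 1)) (Js (k + 1 + 1))"
      using Suc.prems by (intro half_elementary_equivalence_lind_zeta[OF fp fp half]) auto
    then show ?case using Suc by simp
  qed
  from this[of l] show ?thesis by (simp only: ends order_refl)
qed

end
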